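(* Let $m > n \ge 1$ be relatively prime integers of opposite parity, so that $(m^2-n^2,\,2mn,\,m^2+n^2)$ is a primitive Pythagorean triple. Then \[ g(m^2-n^2,\,2mn,\,m^2+n^2) = (m-1)(m^2-n^2) + (m-1)(2mn) - (m^2+n^2). \]
   Context: For relatively prime positive integers $a_1,\dots,a_k$, the Frobenius number $g(a_1,\dots,a_k)$ is the largest integer that cannot be written as $x_1a_1+\dots+x_ka_k$ with all $x_i$ nonnegative integers. *)

theory Defs
  imports Complex_Main
begin

definition representable :: "int list \<Rightarrow> int \<Rightarrow> bool" where
  "representable as N \<longleftrightarrow>
     (\<exists>x :: nat \<Rightarrow> nat. N = (\<Sum>i<length as. int (x i) * as ! i))"

(* The maximum is over all integers, so the value can be negative (it is -1 when some
   generator is 1). Meaningful for lists of positive integers with gcd 1; otherwise no greatest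
   non-representable integer need exist and the value is then unspecified. *)
definition frobenius_number :: "int list \<Rightarrow> int" where
  "frobenius_number as = (GREATEST N. \<not> representable as N)"

lemma frobenius_number_eqI:
  assumes "\<not> representable as g" and "\<And>N. N > g \<Longrightarrow> representable as N"
  shows "frobenius_number as = g"
  unfolding frobenius_number_def
  by (rule Greatest_equality) (use assms not_le in blast)+

definition primitive_pythagorean_triple :: "int \<Rightarrow> int \<Rightarrow> int \<Rightarrow> bool" where
  "primitive_pythagorean_triple a b c \<longleftrightarrow>
     a > 0 \<and> b > 0 \<and> c > 0 \<and> a^2 + b^2 = c^2 \<and> Gcd {a, b, c} = 1"

end

(* Write a, b, c for the three generators.  The pairs (x, y) with c dividing x a + y b form the
   lattice spanned by (m, n) and (n, -m), via the relations m a + n b = m c and m b = n a + n c;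
   their consequence (m + n) a = (m - n) b + (m - n) c is used as well.  Consider a residue class
   modulo c and the smallest x a + y b with x, y >= 0 in it.  By the three relations (x, y) lies in
   the L-shaped region y < m, x < m + n, (x < m or y < n), and on this region x a + y b is at most
   its value at the corner (m - 1, m - 1).  Hence every integer above (m - 1) a + (m - 1) b - c is
   representable.  That number itself is not: a representation would produce a lattice point
   (p, q) with p, q < m and p a + q b > 0, and the lattice basis shows that there is none. *)
theory Submission
  imports Defs
begin

lemma representable_triple_iff:
  "representable [a, b, c] N \<longleftrightarrow>
     (\<exists>x y z. 0 \<le> x \<and> 0 \<le> y \<and> 0 \<le> z \<and> N = x * a + y * b + z * c)"
proof
  assume "representable [a, b, c] N"
  then obtain f :: "nat \<Rightarrow> nat" where "N = (\<Sum>i<3. int (f i) * [a, b, c] ! i)"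
    by (auto simp: representable_def numeral_3_eq_3)
  then have "N = int (f 0) * a + int (f 1) * b + int (f 2) * c"
    by (simp add: numeral_3_eq_3 numeral_2_eq_2)
  then show "\<exists>x y z. 0 \<le> x \<and> 0 \<le> y \<and> 0 \<le> z \<and> N = x * a + y * b + z * c"
    using of_nat_0_le_iff by blast
next
  assume "\<exists>x y z. 0 \<le> x \<and> 0 \<le> y \<and> 0 \<le> z \<and> N = x * a + y * b + z * c"
  then obtain x y z where "0 \<le> x" "0 \<le> y" "0 \<le> z" "N = x * a + y * b + z * c"
    by blast
  then show "representable [a, b, c] N"
    unfolding representable_def
    by (intro exI[of _ "\<lambda>i. nat ([x, y, z] ! i)"]) (simp add: numeral_2_eq_2)
qed

text \<open>A Bezout coefficient scaled by \<open>N\<close> may be negative; reducing it modulo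
  \<open>c\<close> repairs this. It makes the later minimisation start from a nonempty set.\<close>

lemma nonneg_combination_in_residue_class:
  fixes a c N :: int
  assumes "coprime a c" "c > 0"
  shows "\<exists>x\<ge>0. c dvd N - x * a"
proof -
  obtain u v where "u * a + v * c = 1"
    using bezout_int[of a c] assms(1) by auto
  then have "N - N * u * a = c * (N * v)"
    by algebra
  then have "c dvd N - N * u * a"
    by simp
  moreover have "c dvd (N * u - N * u mod c) * a"
    by (simp add: dvd_minus_mod)
  ultimately have "c dvd (N - N * u * a) + (N * u - N * u mod c) * a"
    by (rule dvd_add)
  then have "c dvd N - (N * u mod c) * a"
    by (simp add: algebra_simps)
  then show ?thesis
    using pos_mod_sign[OF assms(2)] by blast
qed

locale euclid_parameters =
  fixes m n :: int
  assumes less: "n < m" and pos: "1 \<le> n" and coprime: "coprime m n"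
    and parity: "even m \<longleftrightarrow> odd n"
begin

definition a where "a = m^2 - n^2"
definition b where "b = 2 * m * n"
definition c where "c = m^2 + n^2"

lemma a_pos: "0 < a"
  using less pos by (simp add: a_def power_strict_mono)

lemma b_pos: "0 < b"
  using less pos by (simp add: b_def)

lemma c_pos: "0 < c"
  using less pos by (simp add: c_def add_pos_pos)

lemma coprime_c_m: "coprime c m"
proof -
  have "gcd m (m * m + n^2) = gcd m (n^2)"
    by (rule gcd_add_mult)
  then have "coprime m (m * m + n^2)"
    using coprime by (simp add: coprime_iff_gcd_eq_1 [symmetric])
  then show ?thesis
    by (simp add: c_def power2_eq_square coprime_commute)
qed

text \<open>Opposite parity enters here: it makes \<open>c\<close> odd, so that 2 as well as
  \<open>m\<close> can be cancelled modulo \<open>c\<close>.\<close>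

lemma coprime_c_2m: "coprime c (2 * m)"
proof -
  have "odd c"
    using parity by (auto simp: c_def)
  then show ?thesis
    using coprime_c_m by simp
qed

text \<open>Modulo \<open>c\<close>, \<open>a\<close> is \<open>2 * m * m\<close>, a product of
  units.\<close>

lemma coprime_a_c: "coprime a c"
proof -
  have "coprime c (2 * m * m + - 1 * c)"
    using coprime_c_2m coprime_c_m
    by (metis coprime_mult_right_iff gcd_add_mult coprime_iff_gcd_eq_1 add.commute)
  moreover have "2 * m * m + - 1 * c = a"
    by (simp add: a_def c_def power2_eq_square)
  ultimately show ?thesis
    by (simp add: coprime_commute)
qed

lemma primitive_triple: "primitive_pythagorean_triple a b c"
proof -
  have "a^2 + b^2 = c^2"
    unfolding a_def b_def c_def by algebra
  moreover have "gcd a (gcd b c) = 1"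
    using coprime_a_c by (metis coprime_iff_gcd_eq_1 gcd.left_commute gcd_1_int gcd.commute)
  ultimately show ?thesis
    using a_pos b_pos c_pos by (simp add: primitive_pythagorean_triple_def)
qed

text \<open>For the Gaussian integer w = m + n i one has a + b i = w^2, and conj(w) w^2 = c w. Real
  and imaginary parts give the first two relations; their difference is the third.\<close>

lemma relations:
  "m * a + n * b = m * c"
  "m * b = n * a + n * c"
  "(m + n) * a = (m - n) * b + (m - n) * c"
  unfolding a_def b_def c_def by algebra+

text \<open>The vectors (m, n) and (n, -m) are orthogonal with squared length \<open>c\<close>, so
  \<open>s\<close> and \<open>t\<close> are the inner products of (p, q) with them, divided by
  \<open>c\<close>. These divisions are exact because \<open>2 * m\<close> and \<open>m\<close> are
  units modulo \<open>c\<close>.\<close>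

lemma relation_lattice_basis:
  assumes "c dvd p * a + q * b"
  obtains s t where "p = s * m + t * n" "q = s * n - t * m" "p * a + q * b = (s * m - t * n) * c"
proof -
  have "2 * m * (p * m + q * n) = (p * a + q * b) + p * c"
    unfolding a_def b_def c_def by algebra
  then have "c dvd 2 * m * (p * m + q * n)"
    using assms by simp
  then have "c dvd p * m + q * n"
    using coprime_c_2m by (simp only: coprime_dvd_mult_right_iff)
  then obtain s where s: "p * m + q * n = c * s" ..
  have "m * (p * n - q * m) = n * (p * m + q * n) - q * c"
    unfolding c_def by algebra
  then have "c dvd m * (p * n - q * m)"
    using s by simp
  then have "c dvd p * n - q * m"
    using coprime_c_m by (simp only: coprime_dvd_mult_right_iff)
  then obtain t where t: "p * n - q * m = c * t" ..
  have "c * p = c * (s * m + t * n)" "c * q = c * (s * n - t * m)"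
    using s t unfolding c_def by algebra+
  then have pq: "p = s * m + t * n" "q = s * n - t * m"
    using c_pos by simp_all
  moreover have "p * a + q * b = (s * m - t * n) * c"
    unfolding pq using relations(1,2) by algebra
  ultimately show thesis ..
qed

lemma frobenius_not_representable:
  "\<not> representable [a, b, c] ((m - 1) * a + (m - 1) * b - c)"
proof
  assume "representable [a, b, c] ((m - 1) * a + (m - 1) * b - c)"
  then obtain x y z where nonneg: "0 \<le> x" "0 \<le> y" "0 \<le> z"
    and eq: "(m - 1) * a + (m - 1) * b - c = x * a + y * b + z * c"
    by (auto simp: representable_triple_iff)
  \<comment> \<open>Subtracting the representation from the corner leaves a lattice point. The
    \<open>- c\<close> in the claimed number turns \<open>z\<close> into \<open>z + 1\<close>, so
    its value is positive even for \<open>z = 0\<close>.\<close>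
  define p where "p = m - 1 - x"
  define q where "q = m - 1 - y"
  have pq: "p * a + q * b = (z + 1) * c"
    using eq by (simp add: p_def q_def algebra_simps)
  then obtain s t where p: "p = s * m + t * n" and q: "q = s * n - t * m"
    and "p * a + q * b = (s * m - t * n) * c"
    using relation_lattice_basis by (metis dvd_triv_right)
  with pq have "s * m - t * n = z + 1"
    using c_pos by simp
  then have *: "t * n < s * m"
    using nonneg by linarith
  \<comment> \<open>For \<open>s > 0\<close>, the sign of \<open>t\<close> decides: \<open>p\<close>
    is large if \<open>t\<close> is nonnegative, \<open>q\<close> otherwise. For
    \<open>s \<le> 0\<close>, positivity forces \<open>t < s\<close>, and then q \<ge> (s - t) m
    \<ge> m.\<close>
  have "m \<le> p \<or> m \<le> q"
  proof (cases "0 < s")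
    case True
    then have sm: "m \<le> s * m" and sn: "0 \<le> s * n"
      using less pos by simp_all
    show ?thesis
    proof (cases "0 \<le> t")
      case True
      then have "0 \<le> t * n"
        using pos by simp
      then show ?thesis
        using sm p by linarith
    next
      case False
      then have "1 * m \<le> - t * m"
        using less pos by (intro mult_right_mono) auto
      then show ?thesis
        using sn q by linarith
    qed
  next
    case False
    then have "s * m \<le> s * n"
      using less by (intro mult_left_mono_neg) auto
    then have "t * n < s * n"
      using * by linarith
    then have "t < s"
      using pos by simp
    then have "1 * m \<le> (s - t) * m"
      using less pos by (intro mult_right_mono) auto
    then show ?thesis
      using \<open>s * m \<le> s * n\<close> q by (simp add: algebra_simps)
  qed
  then show False
    using nonneg by (simp add: p_def q_def)
qed

lemma reduced_combination_in_residue_class: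
  obtains x y where "0 \<le> x" "0 \<le> y" "c dvd N - (x * a + y * b)"
    "x * a + y * b \<le> (m - 1) * a + (m - 1) * b"
proof -
  define P where "P = (\<lambda>(x, y). 0 \<le> x \<and> 0 \<le> y \<and> c dvd N - (x * a + y * b))"
  obtain x\<^sub>0 where "0 \<le> x\<^sub>0" "c dvd N - x\<^sub>0 * a"
    using nonneg_combination_in_residue_class[OF coprime_a_c c_pos] by blast
  then have "P (x\<^sub>0, 0)"
    by (simp add: P_def)
  \<comment> \<open>All values on \<open>P\<close> are nonnegative, so minimising their
    \<open>nat\<close> minimises the values themselves.\<close>
  then obtain x y where "P (x, y)"
    and min: "\<And>x' y'. P (x', y') \<Longrightarrow> nat (x * a + y * b) \<le> nat (x' * a + y' * b)"
    using ex_has_least_nat[of P _ "\<lambda>(x, y). nat (x * a + y * b)"] by fastforce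
  then have x: "0 \<le> x" and y: "0 \<le> y" and cong: "c dvd N - (x * a + y * b)"
    by (simp_all add: P_def)
  have irreducible: False
    if "0 \<le> x'" "0 \<le> y'" "x * a + y * b = x' * a + y' * b + k * c" "0 < k" for x' y' k
  proof -
    have "N - (x' * a + y' * b) = (N - (x * a + y * b)) + k * c"
      using that by simp
    then have "c dvd N - (x' * a + y' * b)"
      using cong by (metis dvd_add dvd_triv_right)
    then have "P (x', y')"
      using that by (simp add: P_def)
    then have "nat (x * a + y * b) \<le> nat (x' * a + y' * b)"
      by (rule min)
    moreover have "0 \<le> x' * a + y' * b" "0 < k * c"
      using that a_pos b_pos c_pos by simp_all
    ultimately show False
      using that by simp
  qed
  \<comment> \<open>If one of the next three bounds failed, a relation would give another pair in
    the quadrant whose value is lower by \<open>n * c\<close>, \<open>(m - n) * c\<close> or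
    \<open>m * c\<close> respectively.\<close>
  have ym: "y < m"
  proof (rule ccontr)
    assume "\<not> y < m"
    then show False
      using irreducible[of "x + n" "y - m" n] relations(2) x pos
      by (simp add: algebra_simps)
  qed
  have xmn: "x < m + n"
  proof (rule ccontr)
    assume "\<not> x < m + n"
    then show False
      using irreducible[of "x - (m + n)" "y + (m - n)" "m - n"] relations(3) y less
      by (simp add: algebra_simps)
  qed
  have corner: "x < m \<or> y < n"
  proof (rule ccontr)
    assume "\<not> (x < m \<or> y < n)"
    then show False
      using irreducible[of "x - m" "y - n" m] relations(1) less pos
      by (simp add: algebra_simps)
  qed
  have bound: "x * a + y * b \<le> u * a + v * b" if "x \<le> u" "y \<le> v" for u v
    using that a_pos b_pos by (intro add_mono mult_right_mono) auto
  have "x * a + y * b \<le> (m - 1) * a + (m - 1) * b"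
  proof (cases "x < m")
    case True
    then show ?thesis
      using ym by (intro bound) auto
  next
    case False
    \<comment> \<open>This is the other outer corner of the L; its value falls short of that at (m -
      1, m - 1) by \<open>n * (m - n)^2\<close>.\<close>
    then have "x * a + y * b \<le> (m + n - 1) * a + (n - 1) * b"
      using xmn corner by (intro bound) auto
    also have "\<dots> = (m - 1) * a + (m - 1) * b - n * (m - n)^2"
      unfolding a_def b_def by algebra
    also have "\<dots> \<le> (m - 1) * a + (m - 1) * b"
      using pos by simp
    finally show ?thesis .
  qed
  with x y cong show thesis
    by (rule that)
qed

lemma representable_above_frobenius:
  assumes "(m - 1) * a + (m - 1) * b - c < N"
  shows "representable [a, b, c] N"
proof -
  obtain x y where xy: "0 \<le> x" "0 \<le> y" "c dvd N - (x * a + y * b)"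
    "x * a + y * b \<le> (m - 1) * a + (m - 1) * b"
    by (rule reduced_combination_in_residue_class)
  then obtain z where z: "N - (x * a + y * b) = c * z"
    by blast
  \<comment> \<open>The strict bound on \<open>N\<close> gives a quotient above -1, which for an
    integer means nonnegative.\<close>
  then have "c * (- 1) < c * z"
    using xy assms by linarith
  then have "- 1 < z"
    using c_pos mult_less_cancel_left_pos by blast
  then have "0 \<le> z"
    by simp
  moreover have "N = x * a + y * b + z * c"
    using z by (simp add: algebra_simps)
  ultimately show ?thesis
    using xy representable_triple_iff by blast
qed

lemma frobenius_number_triple:
  "frobenius_number [a, b, c] = (m - 1) * a + (m - 1) * b - c"
  using frobenius_not_representable representable_above_frobenius by (rule frobenius_number_eqI)

end

theorem mainTheorem1:
  fixes m n :: int
  assumes "m > n" and "n \<ge> 1" and "coprime m n" and "even m \<longleftrightarrow> odd n"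
  shows "primitive_pythagorean_triple (m^2 - n^2) (2 * m * n) (m^2 + n^2)
    \<and> frobenius_number [m^2 - n^2, 2 * m * n, m^2 + n^2]
        = (m - 1) * (m^2 - n^2) + (m - 1) * (2 * m * n) - (m^2 + n^2)"
proof -
  interpret euclid_parameters m n
    using assms by unfold_locales
  show ?thesis
    using primitive_triple frobenius_number_triple unfolding a_def b_def c_def ..
qed

end
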